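(* Let $(X,\sigma)$ be a two-sided subshift over a finite alphabet $\mathcal A$, and let $\varphi,h:X\to\mathbb R$ be continuous functions with $h(x)<0$ for all $x\in X$. Then $$\tilde P_X(\sigma,\varphi)=P_X(\sigma,\varphi),$$ where $P_X(\sigma,\varphi)$ is the topological pressure of $\varphi$ on $X$ and $\tilde P_X(\sigma,\varphi)$ is the quantity defined through covers by cylinders from the families $\mathcal A_r$ determined by $h$.
   Context: Two-sided subshift: let $\mathcal A=\{1,\dots,l\}$, let $\mathcal A^{\mathbb Z}$ carry the metric $d(w,w')=\sum_{j\in\mathbb Z}e^{-|j|}|i_j-i'_j|$ for $w=(i_j)$, $w'=(i'_j)$, and the shift $(\sigma w)_j=i_{j+1}$; $X\subset\mathcal A^{\mathbb Z}$ is nonempty, compact, with $\sigma X=X$. $S_n\psi=\sum_{k=0}^{n-1}\psi\circ\sigma^k$ (and $S_0\psi=0$). $X^*$ is the set of finite words allowed in $X$. For a word $I=i_0\dots i_{n-1}$, $|I|=n$ and $[I]$ is the cylinder of sequences whose coordinates at positions $0,\dots,n-1$ are $i_0,\dots,i_{n-1}$ (the cylinder of the empty word is the whole space). For $r>0$, $$\mathcal A_r=\Big\{i_0\dots i_{n-1}\in X^*:\sup_{x\in[i_0\dots i_{n-1}]\cap X}\exp(S_nh(x))<r\le\sup_{y\in[i_0\dots i_{n-2}]\cap X}\exp(S_{n-1}h(y))\Big\}.$$ For $Z\subset X$, $\lambda\in\mathbb R$, $r>0$, $$\tilde m_P(Z,\lambda,\varphi,r)=\inf\sum_i\exp(-\lambda|I_i|)\sup_{x\in[I_i]\cap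 X}\exp(S_{|I_i|}\varphi(x)),$$ the infimum being over all covers of $Z$ of the form $\{[I_i]\}$ with $I_i\in\mathcal A_{r_i}$ and $r_i\le r$. Then $\tilde m_P(Z,\lambda,\varphi)=\lim_{r\to0}\tilde m_P(Z,\lambda,\varphi,r)$ and $\tilde P_Z(\sigma,\varphi)=\inf\{\lambda\in\mathbb R:\tilde m_P(Z,\lambda,\varphi)=0\}$. Topological pressure on subsets: for $\delta>0$, $N\in\mathbb N$, let $\mathcal P(Z,N,\delta)$ be the family of countable collections $\{(x_i,n_i)\}\subset Z\times\{N,N+1,\dots\}$ with $Z\subset\bigcup_iB_{n_i}(x_i,\delta)$, where $B_n(x,\delta)=\{y\in X:d(\sigma^jx,\sigma^jy)<\delta,\ 0\le j\le n-1\}$. Put $m_P(Z,s,\varphi,N,\delta)=\inf_{\mathcal P(Z,N,\delta)}\sum_i\exp(-n_is+S_{n_i}\varphi(x_i))$, $m_P(Z,s,\varphi,\delta)=\lim_{N\to\infty}m_P(Z,s,\varphi,N,\delta)$, $P_Z(\varphi,\delta)=\inf\{s\in\mathbb R:m_P(Z,s,\varphi,\delta)=0\}$, and $P_Z(\sigma,\varphi)=\lim_{\delta\to0}P_Z(\varphi,\delta)$. For $Z=X$ this is the usual topological pressure. *)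

theory Defs
  imports "HOL-Analysis.Analysis"
begin

definition full_shift :: "nat \<Rightarrow> (int \<Rightarrow> nat) set" where
  "full_shift l = {w. \<forall>j. w j \<in> {1..l}}"

definition seq_dist :: "(int \<Rightarrow> nat) \<Rightarrow> (int \<Rightarrow> nat) \<Rightarrow> real" where
  "seq_dist w w' = (\<Sum>\<^sub>\<infinity>j\<in>UNIV. exp (- \<bar>real_of_int j\<bar>) * \<bar>real (w j) - real (w' j)\<bar>)"

definition shift_map :: "(int \<Rightarrow> nat) \<Rightarrow> (int \<Rightarrow> nat)" where
  "shift_map w = (\<lambda>j. w (j + 1))"

lemma summable_exp_abs_int: "(\<lambda>j::int. exp (- \<bar>real_of_int j\<bar>)) summable_on UNIV"
proof -
  let ?f = "\<lambda>j::int. exp (- \<bar>real_of_int j\<bar>)"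
  have "summable (\<lambda>n. norm (exp (- 1::real) ^ n))"
    by (simp add: norm_power summable_geometric)
  moreover have "exp (- 1::real) ^ n = exp (- real n)" for n
    by (simp flip: exp_of_nat_mult)
  ultimately have nat: "(\<lambda>n::nat. exp (- real n)) summable_on UNIV"
    by (intro norm_summable_imp_summable_on) simp
  have "?f summable_on range int"
    by (subst summable_on_reindex) (use nat in \<open>auto simp: o_def\<close>)
  moreover have "?f summable_on range (\<lambda>n. - int n)"
    by (subst summable_on_reindex) (use nat in \<open>auto simp: o_def inj_on_def\<close>)
  ultimately have "?f summable_on (range int \<union> range (\<lambda>n. - int n))"
    by (rule summable_on_union)
  moreover have "range int \<union> range (\<lambda>n. - int n) = UNIV"
    by (auto intro: int_cases2)
  ultimately show ?thesis by simp
qed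

lemma summable_seq_dist:
  assumes "w \<in> full_shift l" "w' \<in> full_shift l"
  shows "(\<lambda>j. exp (- \<bar>real_of_int j\<bar>) * \<bar>real (w j) - real (w' j)\<bar>) summable_on UNIV"
proof (rule summable_on_comparison_test)
  show "(\<lambda>j. exp (- \<bar>real_of_int j\<bar>) * real l) summable_on UNIV"
    by (intro summable_on_cmult_left summable_exp_abs_int)
  fix j :: int
  have "w j \<le> l" "w' j \<le> l"
    using assms by (auto simp: full_shift_def)
  then show "exp (- \<bar>real_of_int j\<bar>) * \<bar>real (w j) - real (w' j)\<bar> \<le> exp (- \<bar>real_of_int j\<bar>) * real l"
    by (intro mult_left_mono) auto
qed auto

lemma Metric_space_seq_dist: "Metric_space (full_shift l) seq_dist"
proof
  show "0 \<le> seq_dist x y" for x y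
    unfolding seq_dist_def by (intro infsum_nonneg) auto
  show "seq_dist x y = seq_dist y x" for x y
    by (simp add: seq_dist_def abs_minus_commute)
next
  fix x y assume xy: "x \<in> full_shift l" "y \<in> full_shift l"
  show "seq_dist x y = 0 \<longleftrightarrow> x = y"
  proof
    assume "seq_dist x y = 0"
    then have "exp (- \<bar>real_of_int j\<bar>) * \<bar>real (x j) - real (y j)\<bar> = 0" for j
      unfolding seq_dist_def
      using nonneg_infsum_le_0D[OF _ summable_seq_dist[OF xy], of j] by auto
    then show "x = y" by auto
  qed (simp add: seq_dist_def)
next
  fix x y z assume s: "x \<in> full_shift l" "y \<in> full_shift l" "z \<in> full_shift l"
  have "seq_dist x z \<le> (\<Sum>\<^sub>\<infinity>j\<in>UNIV. exp (- \<bar>real_of_int j\<bar>) * \<bar>real (x j) - real (y j)\<bar>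
      + exp (- \<bar>real_of_int j\<bar>) * \<bar>real (y j) - real (z j)\<bar>)"
    unfolding seq_dist_def
    by (intro infsum_mono summable_on_add summable_seq_dist[where l = l] s)
       (simp flip: distrib_left)
  also have "\<dots> = seq_dist x y + seq_dist y z"
    unfolding seq_dist_def by (intro infsum_add summable_seq_dist[where l = l] s)
  finally show "seq_dist x z \<le> seq_dist x y + seq_dist y z" .
qed

abbreviation shift_topology :: "nat \<Rightarrow> (int \<Rightarrow> nat) topology" where
  "shift_topology l \<equiv> Metric_space.mtopology (full_shift l) seq_dist"

definition two_sided_subshift :: "nat \<Rightarrow> (int \<Rightarrow> nat) set \<Rightarrow> bool" where
  "two_sided_subshift l X \<longleftrightarrow>
     X \<noteq> {} \<and> X \<subseteq> full_shift l \<and> compactin (shift_topology l) X \<and> shift_map ` X = X"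

definition birkhoff_sum :: "((int \<Rightarrow> nat) \<Rightarrow> real) \<Rightarrow> nat \<Rightarrow> (int \<Rightarrow> nat) \<Rightarrow> real" where
  "birkhoff_sum \<psi> n x = (\<Sum>k<n. \<psi> ((shift_map ^^ k) x))"

definition allowed_words :: "(int \<Rightarrow> nat) set \<Rightarrow> nat list set" where
  "allowed_words X = {w. \<exists>x\<in>X. \<exists>m::int. \<forall>k<length w. x (m + int k) = w ! k}"

definition cylinder :: "nat list \<Rightarrow> (int \<Rightarrow> nat) set" where
  "cylinder w = {x. \<forall>k<length w. x (int k) = w ! k}"

text \<open>The definition involves the word with its last letter removed, so only nonempty
  words qualify. The suprema are over nonempty bounded sets when \<open>X\<close> is a subshift and
  \<open>h\<close> is continuous on it.\<close>

definition words_at_scale ::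
    "(int \<Rightarrow> nat) set \<Rightarrow> ((int \<Rightarrow> nat) \<Rightarrow> real) \<Rightarrow> real \<Rightarrow> nat list set" where
  "words_at_scale X h r = {w \<in> allowed_words X. w \<noteq> [] \<and>
     (SUP x\<in>cylinder w \<inter> X. exp (birkhoff_sum h (length w) x)) < r \<and>
     r \<le> (SUP y\<in>cylinder (butlast w) \<inter> X. exp (birkhoff_sum h (length w - 1) y))}"

definition scale_covers ::
    "(int \<Rightarrow> nat) set \<Rightarrow> ((int \<Rightarrow> nat) \<Rightarrow> real) \<Rightarrow> (int \<Rightarrow> nat) set \<Rightarrow> real \<Rightarrow> nat list set set" where
  "scale_covers X h Z r = {C. Z \<subseteq> (\<Union>w\<in>C. cylinder w) \<and>
     (\<forall>w\<in>C. \<exists>r'. 0 < r' \<and> r' \<le> r \<and> w \<in> words_at_scale X h r')}"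

text \<open>The outer quantities take values in \<^typ>\<open>ennreal\<close> and the critical exponents in
  \<^typ>\<open>ereal\<close>, so that divergent sums, infima over the empty set, and infima of
  sets unbounded below have their usual meaning.\<close>

definition scale_outer_at ::
    "(int \<Rightarrow> nat) set \<Rightarrow> ((int \<Rightarrow> nat) \<Rightarrow> real) \<Rightarrow> (int \<Rightarrow> nat) set \<Rightarrow> real \<Rightarrow>
     ((int \<Rightarrow> nat) \<Rightarrow> real) \<Rightarrow> real \<Rightarrow> ennreal" where
  "scale_outer_at X h Z s \<phi> r = (INF C\<in>scale_covers X h Z r. \<Sum>\<^sub>\<infinity>w\<in>C.
     ennreal (exp (- s * real (length w)) *
       (SUP x\<in>cylinder w \<inter> X. exp (birkhoff_sum \<phi> (length w) x))))"

definition scale_outer ::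
    "(int \<Rightarrow> nat) set \<Rightarrow> ((int \<Rightarrow> nat) \<Rightarrow> real) \<Rightarrow> (int \<Rightarrow> nat) set \<Rightarrow> real \<Rightarrow>
     ((int \<Rightarrow> nat) \<Rightarrow> real) \<Rightarrow> ennreal" where
  "scale_outer X h Z s \<phi> = Lim (at_right 0) (\<lambda>r. scale_outer_at X h Z s \<phi> r)"

definition scale_pressure ::
    "(int \<Rightarrow> nat) set \<Rightarrow> ((int \<Rightarrow> nat) \<Rightarrow> real) \<Rightarrow> (int \<Rightarrow> nat) set \<Rightarrow>
     ((int \<Rightarrow> nat) \<Rightarrow> real) \<Rightarrow> ereal" where
  "scale_pressure X h Z \<phi> = Inf {ereal s |s. scale_outer X h Z s \<phi> = 0}"

definition bowen_ball ::
    "(int \<Rightarrow> nat) set \<Rightarrow> nat \<Rightarrow> (int \<Rightarrow> nat) \<Rightarrow> real \<Rightarrow> (int \<Rightarrow> nat) set" where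
  "bowen_ball X n x \<delta> =
     {y \<in> X. \<forall>j<n. seq_dist ((shift_map ^^ j) x) ((shift_map ^^ j) y) < \<delta>}"

definition bowen_covers ::
    "(int \<Rightarrow> nat) set \<Rightarrow> (int \<Rightarrow> nat) set \<Rightarrow> nat \<Rightarrow> real \<Rightarrow> ((int \<Rightarrow> nat) \<times> nat) set set" where
  "bowen_covers X Z N \<delta> =
     {C. countable C \<and> C \<subseteq> Z \<times> {N..} \<and> Z \<subseteq> (\<Union>(x, n)\<in>C. bowen_ball X n x \<delta>)}"

definition pressure_outer_at ::
    "(int \<Rightarrow> nat) set \<Rightarrow> (int \<Rightarrow> nat) set \<Rightarrow> real \<Rightarrow> ((int \<Rightarrow> nat) \<Rightarrow> real) \<Rightarrow>
     nat \<Rightarrow> real \<Rightarrow> ennreal" where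
  "pressure_outer_at X Z s \<phi> N \<delta> = (INF C\<in>bowen_covers X Z N \<delta>.
     \<Sum>\<^sub>\<infinity>(x, n)\<in>C. ennreal (exp (- real n * s + birkhoff_sum \<phi> n x)))"

definition pressure_outer ::
    "(int \<Rightarrow> nat) set \<Rightarrow> (int \<Rightarrow> nat) set \<Rightarrow> real \<Rightarrow> ((int \<Rightarrow> nat) \<Rightarrow> real) \<Rightarrow> real \<Rightarrow> ennreal" where
  "pressure_outer X Z s \<phi> \<delta> = lim (\<lambda>N. pressure_outer_at X Z s \<phi> N \<delta>)"

definition pressure_at ::
    "(int \<Rightarrow> nat) set \<Rightarrow> (int \<Rightarrow> nat) set \<Rightarrow> ((int \<Rightarrow> nat) \<Rightarrow> real) \<Rightarrow> real \<Rightarrow> ereal" where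
  "pressure_at X Z \<phi> \<delta> = Inf {ereal s |s. pressure_outer X Z s \<phi> \<delta> = 0}"

definition topological_pressure ::
    "(int \<Rightarrow> nat) set \<Rightarrow> (int \<Rightarrow> nat) set \<Rightarrow> ((int \<Rightarrow> nat) \<Rightarrow> real) \<Rightarrow> ereal" where
  "topological_pressure X Z \<phi> = Lim (at_right 0) (\<lambda>\<delta>. pressure_at X Z \<phi> \<delta>)"

end

theory Submission
  imports Defs
begin

text \<open>
  The family of words admissible at scales at most \<open>r\<close> is squeezed between families defined by
  length alone. Since \<open>h\<close> is negative and continuous on a compact set, it lies between two
  negative constants \<open>-B\<close> and \<open>-c\<close>. Hence the supremum of \<open>exp (S\<^sub>n h)\<close> over a cylinder of length
  \<open>n\<close> lies between \<open>exp (-B n)\<close> and \<open>exp (-c n)\<close> and drops strictly with each further letter: every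
  word with supremum below \<open>r\<close> is admissible at some scale \<open>r' \<le> r\<close>. So every long allowed word is
  admissible, and every admissible word is long (lemmas \<open>long_words_at_scale\<close> and
  \<open>words_at_scale_long\<close>). Thus \<open>h\<close> disappears from the problem, and it remains to compare covers by
  long cylinders with covers by long Bowen balls.

  A Bowen ball \<open>B\<^sub>n(x, \<delta>)\<close> with \<open>\<delta> \<le> 1\<close> is contained in the cylinder of the first \<open>n\<close> letters of
  \<open>x\<close>, because one differing letter at the origin already costs distance \<open>1\<close>. Replacing the value
  of \<open>S\<^sub>n \<phi>\<close> at the centre by the supremum over the cylinder changes it by at most \<open>n \<epsilon> + K\<close>
  (\<open>birkhoff_distortion\<close>), which costs an arbitrarily small increase of the exponent. The
  coordinates near the two ends of the word, where the past or the future is not controlled, only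
  contribute to \<open>K\<close>.

  Conversely, a cylinder of length \<open>n\<close> is not contained in a Bowen ball of order \<open>n\<close> and small
  radius, since such a ball also sees the coordinates just outside the word. But for suitable
  \<open>k\<close>, depending only on \<open>\<delta>\<close> and the alphabet, its image under the \<open>k\<close>-th power of the shift lies in a Bowen ball of order
  \<open>n - 2 k\<close>. As the shift maps \<open>X\<close> onto itself, the images of a cover of \<open>X\<close> still cover \<open>X\<close>, and the
  weights change by a bounded factor only.

  The two comparisons show that the pressure at radius \<open>\<delta>\<close> equals the pressure defined by
  cylinders for every \<open>\<delta> \<le> 1\<close>, so the limit \<open>\<delta> \<rightarrow> 0\<close> is trivial.
\<close>

section \<open>Sums and limits of extended nonnegative numbers\<close>

lemma summable_on_into_ennreal [simp]: "(f :: 'a \<Rightarrow> ennreal) summable_on A"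
  by (rule nonneg_summable_on_complete) simp

text \<open>A cover is replaced by the image of its index set under a map that need not be injective:
  different Bowen balls may have the same initial word. Choosing one preimage for each element of the
  image can only decrease a sum of nonnegative terms.\<close>

lemma infsum_image_le_ennreal:
  fixes g :: "'b \<Rightarrow> ennreal" and f :: "'a \<Rightarrow> ennreal"
  assumes le: "\<And>a. a \<in> A \<Longrightarrow> g (p a) \<le> c * f a"
  shows "infsum g (p ` A) \<le> c * infsum f A"
proof (rule infsum_le_finite_sums)
  fix F assume F: "finite F" "F \<subseteq> p ` A"
  then obtain G where G: "G \<subseteq> A" "inj_on p G" "F = p ` G"
    by (auto simp: subset_image_inj)
  then have "finite G"
    using F(1) finite_imageD by blast
  have "sum g F = (\<Sum>a\<in>G. g (p a))"
    using G by (simp add: sum.reindex)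
  also have "\<dots> \<le> (\<Sum>a\<in>G. c * f a)"
    using G le by (intro sum_mono) auto
  also have "\<dots> = c * infsum f G"
    using \<open>finite G\<close> by (simp add: sum_distrib_left)
  also have "\<dots> \<le> c * infsum f A"
    using G by (intro mult_left_mono infsum_mono_neutral) auto
  finally show "sum g F \<le> c * infsum f A" .
qed simp

text \<open>Critical exponents only depend on where the outer quantities vanish, so a bound up to a
  constant factor, cover by cover, is enough to compare them.\<close>

lemma ennreal_INF_zero_transfer:
  fixes f :: "'a \<Rightarrow> ennreal"
  assumes zero: "(INF a\<in>A. f a) = 0" and c: "0 < c"
    and le: "\<And>a. a \<in> A \<Longrightarrow> P \<le> ennreal c * f a"
  shows "P = 0"
proof -
  have c1: "ennreal (1 / c) * ennreal c = 1"
    using c by (simp flip: ennreal_mult)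
  have "ennreal (1 / c) * P \<le> f a" if "a \<in> A" for a
    using mult_left_mono[OF le[OF that], of "ennreal (1 / c)"] c1
    by (simp add: mult.assoc[symmetric])
  then have "ennreal (1 / c) * P \<le> 0"
    unfolding zero[symmetric] by (rule INF_greatest)
  then show ?thesis
    using c by (simp add: ennreal_eq_0_iff divide_le_0_iff)
qed

lemma Lim_at_right_antimono:
  fixes f :: "real \<Rightarrow> 'a::{complete_linorder,linorder_topology}"
  assumes "\<And>r r'. 0 < r \<Longrightarrow> r \<le> r' \<Longrightarrow> f r' \<le> f r"
  shows "Lim (at_right 0) f = (SUP r\<in>{0<..}. f r)"
proof (rule tendsto_Lim)
  show "(f \<longlongrightarrow> (SUP r\<in>{0<..}. f r)) (at_right 0)"
  proof (rule increasing_tendsto)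
    show "\<forall>\<^sub>F r in at_right 0. f r \<le> (SUP r\<in>{0<..}. f r)"
      by (auto simp: eventually_at_right_field intro!: SUP_upper exI[of _ 1])
    fix x assume "x < (SUP r\<in>{0<..}. f r)"
    then obtain r where "0 < r" "x < f r"
      by (auto simp: less_SUP_iff)
    then have "x < f r'" if "0 < r'" "r' < r" for r'
      using assms[of r' r] that by auto
    with \<open>0 < r\<close> show "\<forall>\<^sub>F r in at_right 0. x < f r"
      unfolding eventually_at_right_field by blast
  qed
qed simp

lemma scale_outer_eq_0_iff:
  "scale_outer X h Z s \<phi> = 0 \<longleftrightarrow> (\<forall>r>0. scale_outer_at X h Z s \<phi> r = 0)"
proof -
  have "scale_outer_at X h Z s \<phi> r' \<le> scale_outer_at X h Z s \<phi> r" if "r \<le> r'" for r r'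
    unfolding scale_outer_at_def
    by (rule INF_superset_mono) (use that in \<open>auto simp: scale_covers_def, fastforce\<close>)
  then have "scale_outer X h Z s \<phi> = (SUP r\<in>{0<..}. scale_outer_at X h Z s \<phi> r)"
    unfolding scale_outer_def by (intro Lim_at_right_antimono)
  then show ?thesis
    by (simp add: bot_ennreal[symmetric] SUP_eq_iff del: bot_ennreal) (auto simp: SUP_bot_conv)
qed

lemma pressure_outer_eq_0_iff:
  "pressure_outer X Z s \<phi> \<delta> = 0 \<longleftrightarrow> (\<forall>N. pressure_outer_at X Z s \<phi> N \<delta> = 0)"
proof -
  have "incseq (\<lambda>N. pressure_outer_at X Z s \<phi> N \<delta>)"
    unfolding pressure_outer_at_def incseq_def
    by (intro allI impI INF_superset_mono) (fastforce simp: bowen_covers_def)+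
  then have "pressure_outer X Z s \<phi> \<delta> = (SUP N. pressure_outer_at X Z s \<phi> N \<delta>)"
    unfolding pressure_outer_def by (intro limI LIMSEQ_SUP)
  then show ?thesis
    by (auto simp: bot_ennreal[symmetric] SUP_bot_conv simp del: bot_ennreal)
qed

section \<open>The metric and the shift\<close>

lemma shift_map_iterate: "(shift_map ^^ n) x = (\<lambda>j. x (j + int n))"
  by (induction n) (auto simp: shift_map_def fun_eq_iff algebra_simps)

lemma seq_dist_small:
  assumes "0 < \<delta>"
  obtains k :: nat where "\<And>x y. x \<in> full_shift l \<Longrightarrow> y \<in> full_shift l \<Longrightarrow>
    (\<And>j. \<bar>j\<bar> \<le> int k \<Longrightarrow> x j = y j) \<Longrightarrow> seq_dist x y < \<delta>"
proof -
  let ?g = "\<lambda>j::int. exp (- \<bar>real_of_int j\<bar>)"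
  have "\<delta> / (real l + 1) > 0"
    using assms by simp
  then obtain F where F: "finite F" "dist (sum ?g F) (infsum ?g UNIV) \<le> \<delta> / (real l + 1)"
    using infsum_finite_approximation[OF summable_exp_abs_int] by blast
  have tail: "infsum ?g (UNIV - F) \<le> \<delta> / (real l + 1)"
    using F by (subst infsum_Diff) (auto simp: summable_exp_abs_int dist_real_def)
  obtain k :: nat where k: "\<And>j. j \<in> F \<Longrightarrow> \<bar>j\<bar> \<le> int k"
  proof -
    have "\<bar>j\<bar> \<le> int (nat (Max (abs ` F)))" if "j \<in> F" for j
    proof -
      have "\<bar>j\<bar> \<le> Max (abs ` F)"
        using that F(1) by (intro Max_ge) auto
      then show ?thesis by linarith
    qed
    then show ?thesis by (rule that)
  qed
  show ?thesis
  proof (rule that)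
    fix x y assume xy: "x \<in> full_shift l" "y \<in> full_shift l"
      and eq: "\<And>j. \<bar>j\<bar> \<le> int k \<Longrightarrow> x j = y j"
    have "seq_dist x y \<le> (\<Sum>\<^sub>\<infinity>j\<in>UNIV - F. ?g j * real l)"
      unfolding seq_dist_def
    proof (rule infsum_mono_neutral)
      show "(\<lambda>j. ?g j * real l) summable_on UNIV - F"
        by (intro summable_on_cmult_left summable_on_subset_banach[OF summable_exp_abs_int]) simp
      show "?g j * \<bar>real (x j) - real (y j)\<bar> \<le> ?g j * real l" for j
      proof -
        have "x j \<le> l" "y j \<le> l"
          using xy by (auto simp: full_shift_def)
        then show ?thesis
          by (intro mult_left_mono) auto
      qed
    qed (use eq k summable_seq_dist[OF xy] in auto)
    also have "\<dots> = infsum ?g (UNIV - F) * real l"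
      by (intro infsum_cmult_left summable_on_subset_banach[OF summable_exp_abs_int]) simp
    also have "\<dots> \<le> \<delta> / (real l + 1) * real l"
      using tail by (intro mult_right_mono) auto
    also have "\<dots> < \<delta>"
      using assms by (simp add: field_simps)
    finally show "seq_dist x y < \<delta>" .
  qed
qed

lemma seq_dist_less_1_imp_eq:
  assumes "x \<in> full_shift l" "y \<in> full_shift l" "seq_dist x y < 1"
  shows "x 0 = y 0"
proof -
  have "(\<Sum>j\<in>{0}. exp (- \<bar>real_of_int j\<bar>) * \<bar>real (x j) - real (y j)\<bar>) \<le> seq_dist x y"
    unfolding seq_dist_def
    by (rule finite_sum_le_infsum) (use summable_seq_dist[OF assms(1,2)] in auto)
  then show ?thesis
    using assms(3) by simp
qed

definition initial_word :: "nat \<Rightarrow> (int \<Rightarrow> nat) \<Rightarrow> nat list" where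
  "initial_word n x = map (\<lambda>k. x (int k)) [0..<n]"

lemma length_initial_word [simp]: "length (initial_word n x) = n"
  by (simp add: initial_word_def)

lemma in_cylinder_initial_word_iff:
  "y \<in> cylinder (initial_word n x) \<longleftrightarrow> (\<forall>k<n. y (int k) = x (int k))"
  by (simp add: cylinder_def initial_word_def)

locale subshift =
  fixes l :: nat and X :: "(int \<Rightarrow> nat) set"
  assumes subshift: "two_sided_subshift l X"
begin

abbreviation cont :: "((int \<Rightarrow> nat) \<Rightarrow> real) \<Rightarrow> bool" where
  "cont \<equiv> continuous_map (subtopology (shift_topology l) X) euclideanreal"

lemma nonempty: "X \<noteq> {}"
  and in_full_shift: "x \<in> X \<Longrightarrow> x \<in> full_shift l"
  and compact_X: "compactin (shift_topology l) X"
  and shift_image: "shift_map ` X = X"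
  using subshift by (auto simp: two_sided_subshift_def)

lemma shift_iterate_image: "(shift_map ^^ n) ` X = X"
proof (induction n)
  case (Suc n)
  have "(shift_map ^^ Suc n) ` X = shift_map ` ((shift_map ^^ n) ` X)"
    by (simp add: image_comp)
  then show ?case
    by (simp add: Suc.IH shift_image)
qed simp

lemma shift_iterate_in: "x \<in> X \<Longrightarrow> (shift_map ^^ n) x \<in> X"
  using shift_iterate_image by blast

lemma shift_iterate_preimage:
  assumes "x \<in> X"
  obtains y where "y \<in> X" "(shift_map ^^ n) y = x"
proof -
  have "x \<in> (shift_map ^^ n) ` X"
    unfolding shift_iterate_image by (rule assms)
  then show ?thesis
    by (elim imageE) (rule that, auto)
qed

lemma initial_word_allowed: "x \<in> X \<Longrightarrow> initial_word n x \<in> allowed_words X"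
  unfolding allowed_words_def initial_word_def by (auto intro!: bexI[of _ x] exI[of _ 0])

lemma allowed_word_cylinder_nonempty:
  assumes "w \<in> allowed_words X"
  obtains x where "x \<in> cylinder w \<inter> X"
proof -
  obtain x m where x: "x \<in> X" "\<And>k. k < length w \<Longrightarrow> x (m + int k) = w ! k"
    using assms by (auto simp: allowed_words_def)
  (* Whatever the sign of m, some forward iterate of a preimage of x carries w at the origin. *)
  obtain y where y: "y \<in> X" "(shift_map ^^ nat (- m)) y = x"
    by (rule shift_iterate_preimage[OF x(1)])
  have "y (int k + int (nat m)) = w ! k" if "k < length w" for k
  proof -
    have "x (m + int k) = y (m + int k + int (nat (- m)))"
      unfolding y(2)[symmetric] shift_map_iterate by (rule refl)
    moreover have "m + int k + int (nat (- m)) = int k + int (nat m)"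
      by simp
    ultimately show ?thesis
      using x(2)[OF that] by metis
  qed
  then have "(shift_map ^^ nat m) y \<in> cylinder w"
    unfolding cylinder_def shift_map_iterate by blast
  then have "(shift_map ^^ nat m) y \<in> cylinder w \<inter> X"
    using shift_iterate_in[OF y(1)] by blast
  then show ?thesis by (rule that)
qed

section \<open>Continuous functions on a subshift\<close>

lemma cont_bounds:
  assumes "cont f"
  obtains a b where "a \<in> X" "b \<in> X" "\<And>x. x \<in> X \<Longrightarrow> f a \<le> f x" "\<And>x. x \<in> X \<Longrightarrow> f x \<le> f b"
proof -
  have "compactin (subtopology (shift_topology l) X) X"
    using compact_X by (simp add: compactin_subtopology)
  from image_compactin[OF this assms] have "compact (f ` X)"
    by simp
  with nonempty show ?thesis
    using compact_attains_sup[of "f ` X"] compact_attains_inf[of "f ` X"] that by blast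
qed

lemma cont_bounded:
  assumes "cont f"
  obtains B where "0 < B" "\<forall>x\<in>X. \<bar>f x\<bar> \<le> B"
proof -
  obtain a b where ab: "\<And>x. x \<in> X \<Longrightarrow> f a \<le> f x" "\<And>x. x \<in> X \<Longrightarrow> f x \<le> f b"
    using cont_bounds[OF assms] by metis
  show ?thesis
  proof (rule that)
    show "0 < \<bar>f a\<bar> + \<bar>f b\<bar> + 1" by simp
    show "\<forall>x\<in>X. \<bar>f x\<bar> \<le> \<bar>f a\<bar> + \<bar>f b\<bar> + 1"
    proof
      fix x assume "x \<in> X"
      then show "\<bar>f x\<bar> \<le> \<bar>f a\<bar> + \<bar>f b\<bar> + 1"
        using ab[of x] by linarith
    qed
  qed
qed

lemma cont_window:
  assumes "cont f" "0 < \<epsilon>"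
  obtains m :: nat where "\<And>x y. x \<in> X \<Longrightarrow> y \<in> X \<Longrightarrow> (\<And>j. \<bar>j\<bar> \<le> int m \<Longrightarrow> x j = y j) \<Longrightarrow>
    \<bar>f x - f y\<bar> < \<epsilon>"
proof -
  interpret Metric_space "full_shift l" seq_dist
    by (rule Metric_space_seq_dist)
  let ?M = "submetric (metric (full_shift l, seq_dist)) X"
  have top: "mtopology_of ?M = subtopology (shift_topology l) X"
    by (simp add: mtopology_of_submetric mtopology_of)
  have "uniformly_continuous_map ?M euclidean_metric f"
    by (rule continuous_imp_uniformly_continuous_map)
       (use compact_X assms(1) in \<open>simp add: top compactin_subspace\<close>)
  moreover have "mspace ?M = X" "mdist ?M = seq_dist"
    using in_full_shift by (auto simp: Metric_space_seq_dist)
  ultimately obtain \<delta> where \<delta>: "\<delta> > 0" "\<And>x y. x \<in> X \<Longrightarrow> y \<in> X \<Longrightarrow> seq_dist y x < \<delta> \<Longrightarrow> \<bar>f y - f x\<bar> < \<epsilon>"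
    using assms(2) unfolding uniformly_continuous_map_def by (auto simp: dist_real_def)
  obtain m :: nat where "\<And>x y. x \<in> full_shift l \<Longrightarrow> y \<in> full_shift l \<Longrightarrow>
    (\<And>j. \<bar>j\<bar> \<le> int m \<Longrightarrow> x j = y j) \<Longrightarrow> seq_dist x y < \<delta>"
    using seq_dist_small[OF \<delta>(1)] by metis
  then show ?thesis
    using \<delta>(2) in_full_shift by (intro that) blast
qed

lemma birkhoff_sum_bound:
  assumes "\<forall>x\<in>X. \<bar>f x\<bar> \<le> B" "x \<in> X"
  shows "\<bar>birkhoff_sum f n x\<bar> \<le> real n * B"
proof -
  have "\<bar>birkhoff_sum f n x\<bar> \<le> (\<Sum>k<n. \<bar>f ((shift_map ^^ k) x)\<bar>)"
    unfolding birkhoff_sum_def by (rule sum_abs)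
  also have "\<dots> \<le> (\<Sum>k<n. B)"
    using assms shift_iterate_in by (intro sum_mono) auto
  finally show ?thesis by simp
qed

lemma birkhoff_sum_le:
  assumes "\<forall>x\<in>X. f x \<le> C" "x \<in> X"
  shows "birkhoff_sum f n x \<le> real n * C"
  unfolding birkhoff_sum_def
  by (rule order_trans[OF sum_mono[of _ _ "\<lambda>_. C"]]) (use assms shift_iterate_in in auto)

lemma bdd_above_birkhoff:
  assumes "cont f"
  shows "bdd_above ((\<lambda>x. exp (birkhoff_sum f n x)) ` (A \<inter> X))"
proof -
  obtain B where B: "\<forall>x\<in>X. \<bar>f x\<bar> \<le> B"
    using cont_bounded[OF assms] by metis
  have "exp (birkhoff_sum f n x) \<le> exp (real n * B)" if "x \<in> X" for x
    using birkhoff_sum_bound[OF B that, of n] by auto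
  then show ?thesis
    by (intro bdd_aboveI2) auto
qed

text \<open>At a position at distance more than \<open>m\<close> from both ends of the common word, the two orbits
  agree on a window of radius \<open>m\<close> and the terms differ by at most \<open>\<epsilon>\<close>. At most \<open>2 m\<close> positions
  remain, and each of them contributes at most twice the bound of \<open>f\<close>.\<close>

lemma birkhoff_distortion:
  assumes "cont f" "0 < \<epsilon>"
  obtains K where "\<And>n x y. x \<in> X \<Longrightarrow> y \<in> X \<Longrightarrow> (\<And>k. k < n \<Longrightarrow> x (int k) = y (int k)) \<Longrightarrow>
    birkhoff_sum f n y \<le> birkhoff_sum f n x + real n * \<epsilon> + K"
proof -
  obtain B where B: "0 < B" "\<forall>x\<in>X. \<bar>f x\<bar> \<le> B"
    using cont_bounded[OF assms(1)] by metis
  obtain m :: nat where m: "\<And>x y. x \<in> X \<Longrightarrow> y \<in> X \<Longrightarrow> (\<And>j. \<bar>j\<bar> \<le> int m \<Longrightarrow> x j = y j) \<Longrightarrow>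
    \<bar>f x - f y\<bar> < \<epsilon>"
    using cont_window[OF assms] by metis
  show ?thesis
  proof (rule that)
    fix n x y assume xy: "x \<in> X" "y \<in> X" and eq: "\<And>k. k < n \<Longrightarrow> x (int k) = y (int k)"
    let ?bad = "{k. k < n \<and> (k < m \<or> n \<le> k + m)}"
    have "birkhoff_sum f n y \<le> (\<Sum>k<n. f ((shift_map ^^ k) x) + \<epsilon> + (if k \<in> ?bad then 2 * B else 0))"
      unfolding birkhoff_sum_def
    proof (intro sum_mono)
      fix k assume "k \<in> {..<n}"
      then have k: "k < n" by simp
      show "f ((shift_map ^^ k) y) \<le> f ((shift_map ^^ k) x) + \<epsilon> + (if k \<in> ?bad then 2 * B else 0)"
      proof (cases "k \<in> ?bad")
        case True
        then show ?thesis
          using bspec[OF B(2) shift_iterate_in[OF xy(1), of k]]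
            bspec[OF B(2) shift_iterate_in[OF xy(2), of k]] assms(2)
          by (simp add: abs_le_iff)
      next
        case False
        have "(shift_map ^^ k) x j = (shift_map ^^ k) y j" if "\<bar>j\<bar> \<le> int m" for j
        proof -
          have "0 \<le> j + int k" "nat (j + int k) < n"
            using that False k by auto
          with eq[of "nat (j + int k)"] show ?thesis
            by (simp add: shift_map_iterate)
        qed
        then have "\<bar>f ((shift_map ^^ k) x) - f ((shift_map ^^ k) y)\<bar> < \<epsilon>"
          by (intro m shift_iterate_in xy)
        then show ?thesis
          using False by (simp only: if_False abs_less_iff) linarith
      qed
    qed
    also have "\<dots> = birkhoff_sum f n x + real n * \<epsilon> + (\<Sum>k<n. if k \<in> ?bad then 2 * B else 0)"
      by (simp add: sum.distrib birkhoff_sum_def)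
    also have "(\<Sum>k<n. if k \<in> ?bad then 2 * B else 0) = (\<Sum>k\<in>?bad. 2 * B)"
      by (rule sum.mono_neutral_cong_right) auto
    also have "\<dots> \<le> real (2 * m) * (2 * B)"
    proof -
      have "card ?bad \<le> card ({..<m} \<union> {n - m..<n})"
        by (rule card_mono) auto
      also have "\<dots> \<le> 2 * m"
        by (rule order_trans[OF card_Un_le]) auto
      finally have "card ?bad \<le> 2 * m" .
      then have "real (card ?bad) * (2 * B) \<le> real (2 * m) * (2 * B)"
        using B(1) by (intro mult_right_mono) linarith+
      then show ?thesis by simp
    qed
    finally show "birkhoff_sum f n y \<le> birkhoff_sum f n x + real n * \<epsilon> + real (2 * m) * (2 * B)"
      by simp
  qed
qed

section \<open>Admissible words are the long words\<close>

abbreviation cyl_sup :: "((int \<Rightarrow> nat) \<Rightarrow> real) \<Rightarrow> nat list \<Rightarrow> real" where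
  "cyl_sup f w \<equiv> (SUP x\<in>cylinder w \<inter> X. exp (birkhoff_sum f (length w) x))"

lemma cyl_sup_upper:
  assumes "cont f" "x \<in> cylinder w \<inter> X"
  shows "exp (birkhoff_sum f (length w) x) \<le> cyl_sup f w"
  using assms(2) by (rule cSUP_upper) (rule bdd_above_birkhoff[OF assms(1)])

text \<open>One more letter multiplies the supremum by at most \<open>exp (-c)\<close>. So, as soon as it has fallen
  below \<open>r\<close>, the scale \<open>min r q\<close>, with \<open>q\<close> the supremum for the word without its last letter,
  meets both defining inequalities.\<close>

lemma long_words_at_scale:
  assumes h: "cont h" "\<And>x. x \<in> X \<Longrightarrow> h x < 0" and r: "0 < r"
  obtains N where "\<And>w. w \<in> allowed_words X \<Longrightarrow> N \<le> length w \<Longrightarrow>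
    \<exists>r'. 0 < r' \<and> r' \<le> r \<and> w \<in> words_at_scale X h r'"
proof -
  obtain b where b: "b \<in> X" "\<And>x. x \<in> X \<Longrightarrow> h x \<le> h b"
    using cont_bounds[OF h(1)] by metis
  define c where "c = - h b"
  have c: "0 < c" and hc: "\<forall>x\<in>X. h x \<le> - c"
    using b h(2) by (auto simp: c_def)
  obtain N :: nat where N: "- ln r / c < real N"
    using reals_Archimedean2 by blast
  show ?thesis
  proof (rule that)
    \<comment> \<open>The bound on the length is \<open>Suc N\<close> so that the empty word is excluded even if \<open>N = 0\<close>.\<close>
    fix w assume w: "w \<in> allowed_words X" and len: "Suc N \<le> length w"
    then have ne: "w \<noteq> []" by auto
    obtain x0 where x0: "x0 \<in> cylinder w \<inter> X"
      using allowed_word_cylinder_nonempty[OF w] .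
    have sub: "cylinder w \<inter> X \<subseteq> cylinder (butlast w) \<inter> X"
      by (auto simp: cylinder_def nth_butlast)
    define q where "q = cyl_sup h (butlast w)"
    have "exp (birkhoff_sum h (length (butlast w)) x0) \<le> q"
      unfolding q_def using x0 sub by (intro cyl_sup_upper[OF h(1)]) auto
    then have q: "0 < q"
      by (rule less_le_trans[rotated]) simp
    have "cyl_sup h w \<le> exp (- c) * q"
    proof (rule cSUP_least)
      show "cylinder w \<inter> X \<noteq> {}" using x0 by auto
      fix x assume x: "x \<in> cylinder w \<inter> X"
      have "birkhoff_sum h (length w) x
          = birkhoff_sum h (length (butlast w)) x + h ((shift_map ^^ length (butlast w)) x)"
        using ne by (cases w rule: rev_cases) (auto simp: birkhoff_sum_def)
      also have "\<dots> \<le> birkhoff_sum h (length (butlast w)) x - c"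
        using bspec[OF hc shift_iterate_in[of x "length (butlast w)"]] x by auto
      finally have "exp (birkhoff_sum h (length w) x)
          \<le> exp (- c) * exp (birkhoff_sum h (length (butlast w)) x)"
        by (simp flip: exp_add)
      also have "\<dots> \<le> exp (- c) * q"
        unfolding q_def using x sub by (intro mult_left_mono cyl_sup_upper[OF h(1)]) auto
      finally show "exp (birkhoff_sum h (length w) x) \<le> exp (- c) * q" .
    qed
    also have "\<dots> < q"
      using q c by simp
    finally have lt1: "cyl_sup h w < q" .
    have "cyl_sup h w \<le> exp (- c * length w)"
      by (rule cSUP_least) (use x0 birkhoff_sum_le[OF hc, of _ "length w"] in \<open>auto simp: mult.commute\<close>)
    also have "\<dots> < r"
    proof -
      have "- ln r < c * real N"
        using N c by (simp add: field_simps)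
      also have "\<dots> \<le> c * length w"
        using c len by (intro mult_left_mono) auto
      finally have "exp (- c * length w) < exp (ln r)"
        by (subst exp_less_cancel_iff) linarith
      then show ?thesis using r by simp
    qed
    finally have lt2: "cyl_sup h w < r" .
    show "\<exists>r'. 0 < r' \<and> r' \<le> r \<and> w \<in> words_at_scale X h r'"
      using lt1 lt2 q r w ne
      by (intro exI[of _ "min r q"]) (auto simp: words_at_scale_def q_def min_def)
  qed
qed

text \<open>The supremum over a cylinder of length \<open>n\<close> is at least \<open>exp (-B n)\<close>, where \<open>B\<close> bounds the
  absolute value of \<open>h\<close>, so it cannot be below \<open>exp (-B N)\<close> for a word shorter than \<open>N\<close>.\<close>

lemma words_at_scale_long:
  assumes "cont h"
  obtains r where "0 < r" "\<And>w r'. r' \<le> r \<Longrightarrow> w \<in> words_at_scale X h r' \<Longrightarrow> N \<le> length w"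
proof -
  obtain B where B: "0 < B" "\<forall>x\<in>X. \<bar>h x\<bar> \<le> B"
    using cont_bounded[OF assms(1)] by metis
  show ?thesis
  proof (rule that)
    show "0 < exp (- (real N * B))" by simp
    fix w r' assume r': "r' \<le> exp (- (real N * B))" and w: "w \<in> words_at_scale X h r'"
    then obtain x where x: "x \<in> cylinder w \<inter> X"
      by (auto simp: words_at_scale_def elim: allowed_word_cylinder_nonempty)
    have "exp (- (length w * B)) \<le> exp (birkhoff_sum h (length w) x)"
      using birkhoff_sum_bound[OF B(2), of x "length w"] x by auto
    also have "\<dots> \<le> cyl_sup h w"
      using x by (rule cyl_sup_upper[OF assms])
    also have "\<dots> < exp (- (real N * B))"
      using w r' by (auto simp: words_at_scale_def)
    finally show "N \<le> length w"
      using B(1) by simp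
  qed
qed

section \<open>Comparison of the two outer quantities\<close>

lemma bowen_ball_subset_cylinder:
  assumes "x \<in> X" "\<delta> \<le> 1" "y \<in> bowen_ball X n x \<delta>"
  shows "y \<in> cylinder (initial_word n x)"
  unfolding in_cylinder_initial_word_iff
proof (intro allI impI)
  fix k assume "k < n"
  then have "y \<in> X" "seq_dist ((shift_map ^^ k) x) ((shift_map ^^ k) y) < 1"
    using assms by (force simp: bowen_ball_def)+
  then have "(shift_map ^^ k) x 0 = (shift_map ^^ k) y 0"
    using assms(1) in_full_shift shift_iterate_in by (intro seq_dist_less_1_imp_eq) auto
  then show "y (int k) = x (int k)"
    by (simp add: shift_map_iterate)
qed

text \<open>Each Bowen ball is replaced by the cylinder of the initial word of its centre. The gap between
  the exponents \<open>s\<close> and \<open>t\<close> absorbs the part of the distortion that is linear in the length.\<close>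

lemma scale_outer_zero_if_pressure_outer_zero:
  assumes \<phi>: "cont \<phi>" and h: "cont h" "\<And>x. x \<in> X \<Longrightarrow> h x < 0" and \<delta>: "\<delta> \<le> 1"
    and zero: "pressure_outer X X s \<phi> \<delta> = 0" and t: "s < t"
  shows "scale_outer X h X t \<phi> = 0"
  unfolding scale_outer_eq_0_iff
proof (intro allI impI)
  fix r :: real assume r: "0 < r"
  obtain K where K: "\<And>n x y. x \<in> X \<Longrightarrow> y \<in> X \<Longrightarrow> (\<And>k. k < n \<Longrightarrow> x (int k) = y (int k)) \<Longrightarrow>
    birkhoff_sum \<phi> n y \<le> birkhoff_sum \<phi> n x + real n * (t - s) + K"
    using birkhoff_distortion[OF \<phi>, of "t - s"] t by auto
  obtain N where N: "\<And>w. w \<in> allowed_words X \<Longrightarrow> N \<le> length w \<Longrightarrow>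
    \<exists>r'. 0 < r' \<and> r' \<le> r \<and> w \<in> words_at_scale X h r'"
    using long_words_at_scale[OF h r] by metis
  show "scale_outer_at X h X t \<phi> r = 0"
  proof (rule ennreal_INF_zero_transfer)
    show "(INF C\<in>bowen_covers X X N \<delta>.
        \<Sum>\<^sub>\<infinity>(x, n)\<in>C. ennreal (exp (- real n * s + birkhoff_sum \<phi> n x))) = 0"
      using zero by (simp add: pressure_outer_eq_0_iff pressure_outer_at_def)
    show "0 < exp K" by simp
    fix C assume C: "C \<in> bowen_covers X X N \<delta>"
    let ?p = "\<lambda>(x, n). initial_word n x"
    have "?p ` C \<in> scale_covers X h X r"
      unfolding scale_covers_def
    proof (intro CollectI conjI ballI subsetI)
      fix y assume "y \<in> X"
      then obtain x n where xn: "(x, n) \<in> C" "y \<in> bowen_ball X n x \<delta>"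
        using C by (auto simp: bowen_covers_def)
      then have "x \<in> X"
        using C by (auto simp: bowen_covers_def)
      with xn bowen_ball_subset_cylinder[OF this \<delta> xn(2)]
      show "y \<in> (\<Union>w\<in>?p ` C. cylinder w)"
        by force
    next
      fix w assume "w \<in> ?p ` C"
      then obtain x n where "(x, n) \<in> C" "w = initial_word n x"
        by auto
      moreover from this have "x \<in> X" "N \<le> n"
        using C by (auto simp: bowen_covers_def)
      ultimately show "\<exists>r'. 0 < r' \<and> r' \<le> r \<and> w \<in> words_at_scale X h r'"
        using N initial_word_allowed by simp
    qed
    then have "scale_outer_at X h X t \<phi> r \<le> (\<Sum>\<^sub>\<infinity>w\<in>?p ` C.
        ennreal (exp (- t * real (length w)) * cyl_sup \<phi> w))"
      unfolding scale_outer_at_def by (rule INF_lower)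
    also have "\<dots> \<le> ennreal (exp K) *
        (\<Sum>\<^sub>\<infinity>(x, n)\<in>C. ennreal (exp (- real n * s + birkhoff_sum \<phi> n x)))"
    proof (rule infsum_image_le_ennreal, safe)
      fix x n assume "(x, n) \<in> C"
      then have x: "x \<in> X"
        using C by (auto simp: bowen_covers_def)
      have "cyl_sup \<phi> (initial_word n x) \<le> exp (birkhoff_sum \<phi> n x + real n * (t - s) + K)"
      proof (rule cSUP_least)
        show "cylinder (initial_word n x) \<inter> X \<noteq> {}"
          using x by (auto simp: in_cylinder_initial_word_iff)
        show "exp (birkhoff_sum \<phi> (length (initial_word n x)) y)
            \<le> exp (birkhoff_sum \<phi> n x + real n * (t - s) + K)"
          if "y \<in> cylinder (initial_word n x) \<inter> X" for y
          using K[OF x, of y n] that by (auto simp: in_cylinder_initial_word_iff)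
      qed
      then have "exp (- t * real n) * cyl_sup \<phi> (initial_word n x)
          \<le> exp (- t * real n) * exp (birkhoff_sum \<phi> n x + real n * (t - s) + K)"
        by (intro mult_left_mono) auto
      also have "\<dots> = exp K * exp (- real n * s + birkhoff_sum \<phi> n x)"
        by (simp flip: exp_add add: algebra_simps)
      finally show "ennreal (exp (- t * real (length (initial_word n x))) * cyl_sup \<phi> (initial_word n x))
          \<le> ennreal (exp K) * ennreal (exp (- real n * s + birkhoff_sum \<phi> n x))"
        by (simp flip: ennreal_mult)
    qed
    finally show "scale_outer_at X h X t \<phi> r \<le> ennreal (exp K) *
        (\<Sum>\<^sub>\<infinity>(x, n)\<in>C. ennreal (exp (- real n * s + birkhoff_sum \<phi> n x)))" .
  qed
qed

text \<open>The shift by \<open>k\<close> centres the word: a point of the shifted cylinder is known on the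
  coordinates from \<open>-k\<close> to \<open>n - k - 1\<close>, so its first \<open>n - 2 k\<close> iterates are known on a window of
  radius \<open>k\<close>.\<close>

lemma shifted_cylinder_subset_bowen_ball:
  assumes k: "\<And>x y. x \<in> full_shift l \<Longrightarrow> y \<in> full_shift l \<Longrightarrow>
      (\<And>j. \<bar>j\<bar> \<le> int k \<Longrightarrow> x j = y j) \<Longrightarrow> seq_dist x y < \<delta>"
    and xy: "x \<in> cylinder w \<inter> X" "y \<in> cylinder w \<inter> X"
  shows "(shift_map ^^ k) y \<in> bowen_ball X (length w - 2 * k) ((shift_map ^^ k) x) \<delta>"
  unfolding bowen_ball_def
proof (intro CollectI conjI allI impI k)
  fix i j assume i: "i < length w - 2 * k" and "\<bar>j\<bar> \<le> int k"
  then have pos: "nat (j + int i + int k) < length w" "0 \<le> j + int i + int k"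
    by auto
  have "x (int (nat (j + int i + int k))) = y (int (nat (j + int i + int k)))"
    using xy pos(1) by (simp add: cylinder_def del: int_nat_eq)
  then have "x (j + int i + int k) = y (j + int i + int k)"
    using pos(2) by simp
  then show "(shift_map ^^ i) ((shift_map ^^ k) x) j = (shift_map ^^ i) ((shift_map ^^ k) y) j"
    by (simp add: shift_map_iterate)
qed (use xy in_full_shift shift_iterate_in in auto)

text \<open>The sum on the left omits the first \<open>k\<close> and the last \<open>k\<close> terms of the one on the right.\<close>

lemma birkhoff_sum_shift_le:
  assumes B: "\<forall>x\<in>X. \<bar>f x\<bar> \<le> B" and x: "x \<in> X" and n: "2 * k \<le> n"
  shows "birkhoff_sum f (n - 2 * k) ((shift_map ^^ k) x) \<le> birkhoff_sum f n x + 2 * real k * B"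
proof -
  have split: "birkhoff_sum f (i + j) z = birkhoff_sum f i z + birkhoff_sum f j ((shift_map ^^ i) z)"
    for i j z
  proof (induction j)
    case (Suc j)
    then show ?case
      by (simp add: birkhoff_sum_def shift_map_iterate algebra_simps)
  qed (simp add: birkhoff_sum_def)
  let ?y = "(shift_map ^^ k) x"
  have "n = k + ((n - 2 * k) + k)"
    using n by simp
  then have "birkhoff_sum f n x = birkhoff_sum f k x + (birkhoff_sum f (n - 2 * k) ?y
      + birkhoff_sum f k ((shift_map ^^ (n - 2 * k)) ?y))"
    by (metis split)
  moreover have "\<bar>birkhoff_sum f k x\<bar> \<le> real k * B"
    "\<bar>birkhoff_sum f k ((shift_map ^^ (n - 2 * k)) ?y)\<bar> \<le> real k * B"
    by (intro birkhoff_sum_bound B x shift_iterate_in)+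
  ultimately show ?thesis
    by linarith
qed

text \<open>A single Bowen ball, centred at a shifted point of the cylinder, replaces each word. Both the
  loss of \<open>2 k\<close> letters in the length and that of \<open>2 k\<close> terms in the Birkhoff sum cost at most a
  constant factor \<open>exp K\<close>, so here the exponent \<open>s\<close> need not be increased.\<close>

lemma pressure_outer_zero_if_scale_outer_zero:
  assumes \<phi>: "cont \<phi>" and h: "cont h" and \<delta>: "0 < \<delta>"
    and zero: "scale_outer X h X s \<phi> = 0"
  shows "pressure_outer X X s \<phi> \<delta> = 0"
  unfolding pressure_outer_eq_0_iff
proof
  fix N :: nat
  obtain B where B: "\<forall>x\<in>X. \<bar>\<phi> x\<bar> \<le> B"
    using cont_bounded[OF \<phi>] by metis
  obtain k :: nat where k: "\<And>x y. x \<in> full_shift l \<Longrightarrow> y \<in> full_shift l \<Longrightarrow>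
      (\<And>j. \<bar>j\<bar> \<le> int k \<Longrightarrow> x j = y j) \<Longrightarrow> seq_dist x y < \<delta>"
    using seq_dist_small[OF \<delta>] by metis
  obtain r where r: "0 < r"
    "\<And>w r'. r' \<le> r \<Longrightarrow> w \<in> words_at_scale X h r' \<Longrightarrow> N + 2 * k \<le> length w"
    using words_at_scale_long[OF h] by metis
  define K where "K = 2 * real k * s + 2 * real k * B"
  define pt where "pt w = (SOME x. x \<in> cylinder w \<inter> X)" for w
  show "pressure_outer_at X X s \<phi> N \<delta> = 0"
  proof (rule ennreal_INF_zero_transfer)
    show "(INF C\<in>scale_covers X h X r. \<Sum>\<^sub>\<infinity>w\<in>C.
        ennreal (exp (- s * real (length w)) * cyl_sup \<phi> w)) = 0"
      using zero r(1) by (simp add: scale_outer_eq_0_iff scale_outer_at_def)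
    show "0 < exp K" by simp
    fix C assume C: "C \<in> scale_covers X h X r"
    have long: "N + 2 * k \<le> length w" and pt: "pt w \<in> cylinder w \<inter> X" if "w \<in> C" for w
    proof -
      have "\<forall>w\<in>C. \<exists>r'. 0 < r' \<and> r' \<le> r \<and> w \<in> words_at_scale X h r'"
        using C by (simp add: scale_covers_def)
      with that obtain r' where r': "r' \<le> r" "w \<in> words_at_scale X h r'"
        by auto
      then show "N + 2 * k \<le> length w"
        by (rule r(2))
      from r' have "w \<in> allowed_words X"
        by (simp add: words_at_scale_def)
      then obtain x where "x \<in> cylinder w \<inter> X"
        by (rule allowed_word_cylinder_nonempty)
      then show "pt w \<in> cylinder w \<inter> X"
        unfolding pt_def by (rule someI[of "\<lambda>x. x \<in> cylinder w \<inter> X"])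
    qed
    let ?p = "\<lambda>w. ((shift_map ^^ k) (pt w), length w - 2 * k)"
    have "?p ` C \<in> bowen_covers X X N \<delta>"
      unfolding bowen_covers_def
    proof (intro CollectI conjI subsetI)
      show "countable (?p ` C)"
        by (intro countable_image countableI_type)
      show "v \<in> X \<times> {N..}" if "v \<in> ?p ` C" for v
      proof -
        from that obtain w where w: "w \<in> C" "v = ?p w"
          by auto
        then show ?thesis
          using long[OF w(1)] shift_iterate_in[of "pt w" k] pt[OF w(1)] by simp
      qed
      fix z assume "z \<in> X"
      then obtain y where y: "y \<in> X" "(shift_map ^^ k) y = z"
        by (rule shift_iterate_preimage)
      obtain w where w: "w \<in> C" "y \<in> cylinder w"
        using y(1) C by (auto simp: scale_covers_def)
      have "z \<in> bowen_ball X (length w - 2 * k) ((shift_map ^^ k) (pt w)) \<delta>"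
        unfolding y(2)[symmetric] using y(1) w pt[OF w(1)]
        by (intro shifted_cylinder_subset_bowen_ball[OF k]) auto
      then show "z \<in> (\<Union>(x, n)\<in>?p ` C. bowen_ball X n x \<delta>)"
        using w(1) by auto
    qed
    then have "pressure_outer_at X X s \<phi> N \<delta> \<le>
        (\<Sum>\<^sub>\<infinity>(x, n)\<in>?p ` C. ennreal (exp (- real n * s + birkhoff_sum \<phi> n x)))"
      unfolding pressure_outer_at_def by (rule INF_lower)
    also have "\<dots> \<le> ennreal (exp K) *
        (\<Sum>\<^sub>\<infinity>w\<in>C. ennreal (exp (- s * real (length w)) * cyl_sup \<phi> w))"
    proof (rule infsum_image_le_ennreal)
      fix w assume w: "w \<in> C"
      have "birkhoff_sum \<phi> (length w - 2 * k) ((shift_map ^^ k) (pt w))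
          \<le> birkhoff_sum \<phi> (length w) (pt w) + 2 * real k * B"
        using long[OF w] pt[OF w] by (intro birkhoff_sum_shift_le B) auto
      then have "exp (- real (length w - 2 * k) * s +
            birkhoff_sum \<phi> (length w - 2 * k) ((shift_map ^^ k) (pt w)))
          \<le> exp (K + (- s * real (length w)) + birkhoff_sum \<phi> (length w) (pt w))"
        using long[OF w] by (simp add: K_def of_nat_diff algebra_simps)
      also have "\<dots> = exp K * (exp (- s * real (length w)) * exp (birkhoff_sum \<phi> (length w) (pt w)))"
        by (simp only: exp_add mult.assoc)
      also have "\<dots> \<le> exp K * (exp (- s * real (length w)) * cyl_sup \<phi> w)"
        by (intro mult_left_mono cyl_sup_upper \<phi> pt w) auto
      finally show "(case ?p w of (x, n) \<Rightarrow> ennreal (exp (- real n * s + birkhoff_sum \<phi> n x)))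
          \<le> ennreal (exp K) * ennreal (exp (- s * real (length w)) * cyl_sup \<phi> w)"
        by (simp add: ennreal_mult'[symmetric] ennreal_leI)
    qed
    finally show "pressure_outer_at X X s \<phi> N \<delta> \<le> ennreal (exp K) *
        (\<Sum>\<^sub>\<infinity>w\<in>C. ennreal (exp (- s * real (length w)) * cyl_sup \<phi> w))" .
  qed
qed

lemma pressure_at_eq_scale_pressure:
  assumes "cont \<phi>" "cont h" "\<And>x. x \<in> X \<Longrightarrow> h x < 0" "0 < \<delta>" "\<delta> \<le> 1"
  shows "pressure_at X X \<phi> \<delta> = scale_pressure X h X \<phi>"
proof (rule antisym)
  show "pressure_at X X \<phi> \<delta> \<le> scale_pressure X h X \<phi>"
    unfolding pressure_at_def scale_pressure_def
    using pressure_outer_zero_if_scale_outer_zero[OF assms(1,2,4)] by (intro Inf_superset_mono) auto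
  show "scale_pressure X h X \<phi> \<le> pressure_at X X \<phi> \<delta>"
    unfolding pressure_at_def
  proof (rule Inf_greatest, safe)
    fix s assume s: "pressure_outer X X s \<phi> \<delta> = 0"
    show "scale_pressure X h X \<phi> \<le> ereal s"
    proof (rule ereal_le_epsilon2)
      fix e :: real assume "0 < e"
      then have "scale_outer X h X (s + e) \<phi> = 0"
        by (intro scale_outer_zero_if_pressure_outer_zero[OF assms(1-3,5) s]) auto
      then show "scale_pressure X h X \<phi> \<le> ereal s + ereal e"
        unfolding scale_pressure_def by (intro Inf_lower) auto
    qed
  qed
qed

end

theorem proposition3p8:
  fixes l :: nat
    and X :: "(int \<Rightarrow> nat) set"
    and \<phi> h :: "(int \<Rightarrow> nat) \<Rightarrow> real"
  assumes "two_sided_subshift l X"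
    and "continuous_map (subtopology (shift_topology l) X) euclideanreal \<phi>"
    and "continuous_map (subtopology (shift_topology l) X) euclideanreal h"
    and "\<And>x. x \<in> X \<Longrightarrow> h x < 0"
  shows "scale_pressure X h X \<phi> = topological_pressure X X \<phi>"
proof -
  interpret subshift l X
    by unfold_locales (rule assms(1))
  have "\<forall>\<^sub>F \<delta> in at_right 0. pressure_at X X \<phi> \<delta> = scale_pressure X h X \<phi>"
    unfolding eventually_at_right_field
    using pressure_at_eq_scale_pressure[OF assms(2-4)] by (intro exI[of _ 1]) auto
  then have "((\<lambda>\<delta>. pressure_at X X \<phi> \<delta>) \<longlongrightarrow> scale_pressure X h X \<phi>) (at_right 0)"
    by (rule tendsto_eventually)
  then show ?thesis
    unfolding topological_pressure_def by (simp add: tendsto_Lim)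
qed

end
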